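(* Let $f\in\mathcal{A}$. If $f$ satisfies the subordination $$\frac{zf'(z)}{f(z)}\left(1+\frac{zf''(z)}{f'(z)}-\frac{zf'(z)}{f(z)}\right)+\frac{zf'(z)}{f(z)}\left(\frac{z^2f'''(z)}{f'(z)}-\frac{3z^2f''(z)}{f(z)}+\frac{2zf''(z)}{f'(z)}+2\left(\frac{zf'(z)}{f(z)}\right)^2-\frac{2zf'(z)}{f(z)}\right)\prec\frac{3z}{8\sqrt{2}},$$ then $f\in\mathcal{SL}$.
   Context: $\mathbb{D}=\{z\in\mathbb{C}:|z|<1\}$. $\mathcal{A}$ is the set of analytic functions $f$ on $\mathbb{D}$ with $f(0)=0$ and $f'(0)=1$. For analytic $f,g$ on $\mathbb{D}$, $f\prec g$ ($f$ is subordinate to $g$) means there is an analytic $w:\mathbb{D}\to\mathbb{D}$ with $w(0)=0$ and $f(z)=g(w(z))$ for all $z\in\mathbb{D}$; in particular the left-hand side of a subordination is understood to be an analytic function on $\mathbb{D}$ (after filling in removable singularities). $\mathcal{SL}$ (lemniscate starlike functions) is the class of $f\in\mathcal{A}$ with $zf'(z)/f(z)\prec\sqrt{1+z}$ (principal branch), i.e. $zf'(z)/f(z)$ takes values in $\{w:|w^2-1|<1,\ \operatorname{Re}w>0\}$ for $z\in\mathbb{D}$. *)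

theory Defs
  imports "HOL-Complex_Analysis.Complex_Analysis"
begin

abbreviation unit_disc :: "complex set" where
  "unit_disc \<equiv> ball 0 1"

(* Functions on the unit disc are total functions whose values outside it are irrelevant. *)
definition class_A :: "(complex \<Rightarrow> complex) set" where
  "class_A = {f. f holomorphic_on unit_disc \<and> f 0 = 0 \<and> deriv f 0 = 1}"

definition subordinate :: "(complex \<Rightarrow> complex) \<Rightarrow> (complex \<Rightarrow> complex) \<Rightarrow> bool"
    (infix "\<prec>\<^sub>s" 50) where
  "f \<prec>\<^sub>s g \<longleftrightarrow>
     f holomorphic_on unit_disc \<and> g holomorphic_on unit_disc \<and>
     (\<exists>w. w holomorphic_on unit_disc \<and> w ` unit_disc \<subseteq> unit_disc \<and> w 0 = 0 \<and>
          (\<forall>z\<in>unit_disc. f z = g (w z)))"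

(* The quotient is 0/0 at the origin; remove_sings replaces the values at removable
   singularities by the limits. It yields 0 at a pole, where the result is not continuous, so
   holomorphy on the disc in subordinate excludes poles. *)
definition class_SL :: "(complex \<Rightarrow> complex) set" where
  "class_SL = {f \<in> class_A.
     remove_sings (\<lambda>z. z * deriv f z / f z) \<prec>\<^sub>s (\<lambda>z. csqrt (1 + z))}"

end

(* With p = z f'/f the left-hand side of the hypothesis is z p' + z^2 p'' = z (z p')'. Since it is
   subordinate to 3z/(8 sqrt 2), Schwarz's lemma bounds it by 3/8 |z|. Dividing by z and
   integrating twice preserves such a bound, so |p - 1| < 3/8, which implies Re p > 0 and
   |p^2 - 1| < 1. To rule out zeros of f other than 0 (poles of p), the equation z (z q')' = F is
   first solved by a holomorphic q on the whole disc; then p = q near 0, the identity theorem gives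
   z f' = q f on the disc, and this linear equation forces f(z)/z to have no zeros. *)
theory Submission
  imports Defs
begin

section \<open>Removable singularities and the equation z g' = f\<close>

text \<open>\<open>remove_sings\<close> takes a limit, and \<open>g\<close> is continuous. Since the
  value \<open>f z\<close> does not enter, two holomorphic functions that agree off a point can be
  shown to agree there by computing the same limit twice.\<close>

lemma remove_sings_eq_holomorphic:
  assumes "open S" "z \<in> S" "g holomorphic_on S" "\<And>y. y \<in> S - {z} \<Longrightarrow> f y = g y"
  shows "remove_sings f z = g z"
proof (rule remove_sings_eqI)
  have "g \<midarrow>z\<rightarrow> g z"
    using assms(1-3) by (metis continuous_on_eq_continuous_at holomorphic_on_imp_continuous_on isContD)
  then show "f \<midarrow>z\<rightarrow> g z"
    by (rule Lim_transform_within_open[OF _ assms(1,2)]) (use assms(4) in auto)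
qed

text \<open>Writing f = z h turns the equation into g' = h. The bound on \<open>f\<close> gives |h|
  \<le> c, so the primitive of \<open>h\<close> vanishing at 0 is bounded by c |z|. The bound has
  the same form for \<open>f\<close> and \<open>g\<close>, so the lemma can be iterated.\<close>

lemma euler_equation_solution:
  assumes f: "f holomorphic_on ball 0 r" and r: "0 < r"
    and bd: "\<And>z. norm z < r \<Longrightarrow> norm (f z) \<le> c * norm z"
  obtains g where "g holomorphic_on ball 0 r" "g 0 = 0"
    "\<And>z. norm z < r \<Longrightarrow> z * deriv g z = f z"
    "\<And>z. norm z < r \<Longrightarrow> norm (g z) \<le> c * norm z"
proof -
  have "f 0 = 0" using bd[of 0] r by simp
  then obtain h where h: "h holomorphic_on ball 0 r" and fh: "\<And>z. norm z < r \<Longrightarrow> f z = z * h z"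
    using Schwarz3[OF f] by metis
  have h_bd: "norm (h z) \<le> c" if z: "z \<in> ball 0 r" for z
  proof (cases "z = 0")
    case False
    then show ?thesis using bd[of z] fh[of z] z by (simp add: norm_mult mult.commute)
  next
    \<comment> \<open>At the origin the factor z cannot be cancelled; the bound is the limit of the
      bounds nearby.\<close>
    case True
    have "h \<midarrow>0\<rightarrow> h 0"
      using h r by (metis centre_in_ball continuous_on_eq_continuous_at holomorphic_on_imp_continuous_on
          isContD open_ball)
    then have lim: "((\<lambda>z. norm (h z)) \<longlongrightarrow> norm (h 0)) (at 0)"
      by (rule tendsto_norm)
    have "\<forall>\<^sub>F z in at 0. norm (h z) \<le> c"
      unfolding eventually_at
    proof (intro exI conjI ballI impI)
      fix y :: complex assume "y \<noteq> 0 \<and> dist y 0 < r"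
      then show "norm (h y) \<le> c"
        using bd[of y] fh[of y] by (simp add: norm_mult mult.commute)
    qed (rule r)
    then show ?thesis using tendsto_upperbound[OF lim] True by simp
  qed
  obtain k where k: "\<And>z. z \<in> ball 0 r \<Longrightarrow> (k has_field_derivative h z) (at z)"
    using holomorphic_convex_primitive'[OF convex_ball open_ball h]
    by (metis at_within_open open_ball)
  define g where "g = (\<lambda>z. k z - k 0)"
  have g': "(g has_field_derivative h z) (at z)" if "z \<in> ball 0 r" for z
    unfolding g_def using k[OF that] by (auto intro!: derivative_eq_intros)
  show thesis
  proof (rule that)
    show "g holomorphic_on ball 0 r"
      using g' by (meson holomorphic_on_open open_ball)
    show "g 0 = 0" by (simp add: g_def)
    show "z * deriv g z = f z" if "norm z < r" for z
      using DERIV_imp_deriv[OF g'] fh that by simp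
    show "norm (g z) \<le> c * norm z" if z: "norm z < r" for z
    proof -
      have "norm (g z - g 0) \<le> c * norm (z - 0)"
        by (rule field_differentiable_bound[of "ball 0 r" g h])
          (use g' h_bd z r in \<open>auto intro: has_field_derivative_at_within\<close>)
      then show ?thesis by (simp add: g_def)
    qed
  qed
qed

text \<open>Off the origin the factor z cancels, and by continuity the derivatives agree at 0 as
  well, so the difference is constant.\<close>

lemma euler_equation_unique:
  assumes f: "f holomorphic_on ball 0 r" and g: "g holomorphic_on ball 0 r"
    and eq: "\<And>z. z \<in> ball 0 r \<Longrightarrow> z * deriv f z = z * deriv g z"
    and "f 0 = g 0" and z: "z \<in> ball 0 r"
  shows "f z = g z"
proof -
  define d where "d = (\<lambda>z. f z - g z)"
  have d: "(d has_field_derivative (deriv f y - deriv g y)) (at y)" if "y \<in> ball 0 r" for y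
    unfolding d_def using f g that by (intro DERIV_diff holomorphic_derivI[OF _ open_ball])
  have hd: "(\<lambda>y. deriv f y - deriv g y) holomorphic_on ball 0 r"
    using f g by (intro holomorphic_intros) auto
  have 0: "0 \<in> ball (0::complex) r" using z by (simp only: mem_ball dist_self) (rule order_le_less_trans[OF zero_le_dist])
  have "deriv f 0 - deriv g 0 = remove_sings (\<lambda>_. 0) 0"
    by (rule remove_sings_eq_holomorphic[OF open_ball 0 hd, symmetric]) (use eq in auto)
  then have "deriv f 0 = deriv g 0" by simp
  then have "deriv f y - deriv g y = 0" if "y \<in> ball 0 r" for y
    using eq[OF that] by (cases "y = 0") auto
  then have "\<exists>c. \<forall>y\<in>ball 0 r. d y = c"
    using d by (intro has_field_derivative_zero_constant)
      (metis convex_ball, metis has_field_derivative_at_within)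
  then have "d z = d 0" using 0 z by metis
  then show ?thesis using \<open>f 0 = g 0\<close> by (simp add: d_def)
qed

section \<open>Linear equations and logarithmic derivatives\<close>

text \<open>If k' = h, then f exp(-k) has derivative 0, so it is a constant, nonzero because of its
  value at \<open>a\<close>.\<close>

lemma linear_ode_nonzero:
  assumes "convex S" "open S" and f: "f holomorphic_on S" and h: "h holomorphic_on S"
    and ode: "\<And>z. z \<in> S \<Longrightarrow> deriv f z = h z * f z"
    and a: "a \<in> S" "f a \<noteq> 0" and z: "z \<in> S"
  shows "f z \<noteq> 0"
proof -
  obtain k where k: "\<And>z. z \<in> S \<Longrightarrow> (k has_field_derivative h z) (at z within S)"
    using holomorphic_convex_primitive'[OF assms(1,2) h] by metis
  have "((\<lambda>z. f z * exp (- k z)) has_field_derivative 0) (at y within S)" if y: "y \<in> S" for y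
  proof -
    have "(f has_field_derivative h y * f y) (at y within S)"
      using holomorphic_derivI[OF f \<open>open S\<close> y] ode[OF y] by simp
    then show ?thesis
      using k[OF y] by (auto intro!: derivative_eq_intros simp: algebra_simps)
  qed
  then obtain c where c: "\<forall>y\<in>S. f y * exp (- k y) = c"
    using has_field_derivative_zero_constant[OF \<open>convex S\<close>, of "\<lambda>z. f z * exp (- k z)"]
    by blast
  then show ?thesis using a z by (metis exp_not_eq_zero mult_eq_0_iff)
qed

text \<open>This identifies the left-hand side of the hypothesis as z (z p')' for p = z f'/f. The
  derivative of \<open>f\<close> must be nonzero only at \<open>z\<close>, where the expression
  divides by it.\<close>

lemma euler_operator_quotient:
  assumes S: "open S" and f: "f holomorphic_on S" and z: "z \<in> S"
    and nz: "\<And>y. y \<in> S \<Longrightarrow> f y \<noteq> 0" "deriv f z \<noteq> 0"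
    and p: "\<And>y. y \<in> S \<Longrightarrow> p y = y * deriv f y / f y"
  shows "z * deriv (\<lambda>z. z * deriv p z) z =
           z * deriv f z / f z *
             (1 + z * (deriv ^^ 2) f z / deriv f z - z * deriv f z / f z)
         + z * deriv f z / f z *
             (z\<^sup>2 * (deriv ^^ 3) f z / deriv f z
              - 3 * z\<^sup>2 * (deriv ^^ 2) f z / f z
              + 2 * z * (deriv ^^ 2) f z / deriv f z
              + 2 * (z * deriv f z / f z)\<^sup>2
              - 2 * z * deriv f z / f z)"
proof -
  define f1 f2 f3 where f123: "f1 = deriv f" "f2 = deriv f1" "f3 = deriv f2"
  have h: "f1 holomorphic_on S" "f2 holomorphic_on S"
    unfolding f123 using f S by (auto intro!: holomorphic_deriv)
  have D: "(f has_field_derivative f1 y) (at y)" "(f1 has_field_derivative f2 y) (at y)"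
     "(f2 has_field_derivative f3 y) (at y)" if "y \<in> S" for y
    using f h S that unfolding f123 by (auto intro: holomorphic_derivI)
  \<comment> \<open>\<open>P1\<close> is p' on \<open>S\<close>, and \<open>P2\<close> is the value
    of p'' at \<open>z\<close>.\<close>
  define P1 where "P1 = (\<lambda>y. f1 y / f y + y * (f2 y / f y - (f1 y / f y)\<^sup>2))"
  define P2 where "P2 = 2 * (f2 z / f z - (f1 z / f z)\<^sup>2)
      + z * (f3 z / f z - 3 * f1 z * f2 z / (f z)\<^sup>2 + 2 * (f1 z / f z) ^ 3)"
  have p1: "deriv p y = P1 y" if y: "y \<in> S" for y
  proof -
    have "((\<lambda>y. y * f1 y / f y) has_field_derivative P1 y) (at y)"
      unfolding P1_def using D[OF y] nz(1)[OF y]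
      by (auto intro!: derivative_eq_intros simp: field_simps power2_eq_square)
    moreover have "deriv p y = deriv (\<lambda>y. y * f1 y / f y) y"
      by (rule deriv_cong_ev) (use p S y in \<open>auto simp: f123 eventually_nhds\<close>)
    ultimately show ?thesis by (simp add: DERIV_imp_deriv)
  qed
  have "((\<lambda>y. y * P1 y) has_field_derivative (P1 z + z * P2)) (at z)"
    unfolding P1_def P2_def using D[OF z] nz(1)[OF z]
    by (auto intro!: derivative_eq_intros simp: field_simps power2_eq_square power3_eq_cube)
  moreover have "deriv (\<lambda>y. y * deriv p y) z = deriv (\<lambda>y. y * P1 y) z"
    by (rule deriv_cong_ev) (use p1 S z in \<open>auto simp: eventually_nhds\<close>)
  ultimately have lhs: "deriv (\<lambda>y. y * deriv p y) z = P1 z + z * P2"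
    by (simp add: DERIV_imp_deriv)
  have d23: "(deriv ^^ 2) f = f2" "(deriv ^^ 3) f = f3"
    by (simp_all add: f123 numeral_eq_Suc)
  \<comment> \<open>In the ratios a = f'/f, b = f''/f, c = f'''/f all powers of \<open>f z\<close>
    cancel, leaving a rational identity with only \<open>a\<close> in denominators.\<close>
  define a b c where abc: "a = f1 z / f z" "b = f2 z / f z" "c = f3 z / f z"
  have nz': "f z \<noteq> 0" "a \<noteq> 0" using nz(1)[OF z] nz(2) by (auto simp: abc f123)
  then have fs: "f1 z = a * f z" "f2 z = b * f z" "f3 z = c * f z" by (auto simp: abc)
  show ?thesis
    unfolding lhs d23 f123(1)[symmetric] P1_def P2_def fs using nz'
    by (simp add: divide_simps) (simp add: algebra_simps power2_eq_square power3_eq_cube)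
qed

text \<open>The identity theorem extends the equation to the large disc. With f = z
  \<open>\<phi>\<close> it reads z \<open>\<phi>\<close>' = (q - 1) \<open>\<phi>\<close>, which
  forces q(0) = 1. Hence q - 1 = z h, and \<open>\<phi>\<close> solves the regular linear equation
  \<open>\<phi>\<close>' = h \<open>\<phi>\<close> with nonzero value at 0.\<close>

lemma logarithmic_derivative_continuation:
  assumes f: "f holomorphic_on ball 0 r" "f 0 = 0" "deriv f 0 \<noteq> 0"
    and q: "q holomorphic_on ball 0 r"
    and e: "0 < e" "e \<le> r" and near: "\<And>z. z \<in> ball 0 e \<Longrightarrow> z * deriv f z = q z * f z"
    and z: "z \<in> ball 0 r"
  shows "z * deriv f z = q z * f z" and "z \<noteq> 0 \<Longrightarrow> f z \<noteq> 0"
proof -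
  have ode: "y * deriv f y = q y * f y" if y: "y \<in> ball 0 r" for y
    by (rule analytic_continuation_open[of "ball 0 e" "ball 0 r"])
      (use f q e near y in \<open>auto intro!: holomorphic_intros\<close>)
  then show "z * deriv f z = q z * f z" using z .
  obtain \<phi> where \<phi>: "\<phi> holomorphic_on ball 0 r" "\<And>z. norm z < r \<Longrightarrow> f z = z * \<phi> z"
    "deriv f 0 = \<phi> 0"
    using Schwarz3[OF f(1,2)] by metis
  have q_eq: "y * deriv \<phi> y = (q y - 1) * \<phi> y" if y: "y \<in> ball 0 r" "y \<noteq> 0" for y
  proof -
    have "((\<lambda>y. y * \<phi> y) has_field_derivative \<phi> y + y * deriv \<phi> y) (at y)"
      using holomorphic_derivI[OF \<phi>(1) open_ball y(1), of UNIV]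
      by (auto intro!: derivative_eq_intros)
    moreover have "deriv f y = deriv (\<lambda>y. y * \<phi> y) y"
      by (rule deriv_cong_ev)
        (use \<phi>(2) y in \<open>auto simp: eventually_nhds intro!: exI[of _ "ball 0 r"]\<close>)
    ultimately have "deriv f y = \<phi> y + y * deriv \<phi> y" by (simp add: DERIV_imp_deriv)
    then have "y * (y * deriv \<phi> y) = y * ((q y - 1) * \<phi> y)"
      using ode[OF y(1)] \<phi>(2)[of y] y(1) by (simp add: algebra_simps)
    then show ?thesis using y(2) by simp
  qed
  have r: "0 \<in> ball (0::complex) r" using e by simp
  \<comment> \<open>The limit of z \<open>\<phi>\<close>' at 0 is computed twice: from the equation
    off 0, and directly as 0.\<close>
  have "(q 0 - 1) * \<phi> 0 = remove_sings (\<lambda>y. y * deriv \<phi> y) 0"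
    by (rule remove_sings_eq_holomorphic[OF open_ball r, symmetric])
      (use \<phi>(1) q q_eq in \<open>auto intro!: holomorphic_intros\<close>)
  also have "\<dots> = 0 * deriv \<phi> 0"
    by (rule remove_sings_eq_holomorphic[OF open_ball r])
      (use \<phi>(1) in \<open>auto intro!: holomorphic_intros\<close>)
  finally have "q 0 - 1 = 0" using f(3) \<phi>(3) by simp
  moreover have "(\<lambda>z. q z - 1) holomorphic_on ball 0 r" using q by (intro holomorphic_intros)
  ultimately obtain h where h: "h holomorphic_on ball 0 r"
    "\<And>z. norm z < r \<Longrightarrow> q z - 1 = z * h z"
    using Schwarz3[of "\<lambda>z. q z - 1" r] by blast
  have "deriv \<phi> y = h y * \<phi> y" if y: "y \<in> ball 0 r" for y
  proof -
    \<comment> \<open>Cancelling z works only off the origin; comparing limits then gives the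
      equation at 0.\<close>
    have *: "deriv \<phi> y = h y * \<phi> y" if "y \<in> ball 0 r - {0}" for y
      using q_eq[of y] h(2)[of y] that by simp
    have "deriv \<phi> 0 = remove_sings (deriv \<phi>) 0"
      by (rule remove_sings_eq_holomorphic[OF open_ball r, symmetric])
        (use \<phi>(1) in \<open>auto intro!: holomorphic_intros\<close>)
    also have "\<dots> = h 0 * \<phi> 0"
      by (rule remove_sings_eq_holomorphic[OF open_ball r])
        (use \<phi>(1) h(1) * in \<open>auto intro!: holomorphic_intros\<close>)
    finally show ?thesis using * y by (cases "y = 0") auto
  qed
  then have "\<phi> z \<noteq> 0"
    using linear_ode_nonzero[OF convex_ball open_ball \<phi>(1) h(1) _ r] f(3) \<phi>(3) z by simp
  then show "f z \<noteq> 0" if "z \<noteq> 0" using \<phi>(2)[of z] z that by simp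
qed

section \<open>The lemniscate domain and the final estimate\<close>

text \<open>The Schwarz function is w = q^2 - 1; positivity of Re q makes \<open>q\<close> the
  principal root of 1 + w.\<close>

lemma subordinate_csqrtI:
  assumes q: "q holomorphic_on unit_disc" "q 0 = 1"
    and bd: "\<And>z. z \<in> unit_disc \<Longrightarrow> norm ((q z)\<^sup>2 - 1) < 1" "\<And>z. z \<in> unit_disc \<Longrightarrow> 0 < Re (q z)"
  shows "q \<prec>\<^sub>s (\<lambda>z. csqrt (1 + z))"
  unfolding subordinate_def
proof (intro conjI exI ballI)
  show "(\<lambda>z. csqrt (1 + z)) holomorphic_on unit_disc"
  proof (intro holomorphic_intros)
    fix z :: complex assume "z \<in> unit_disc"
    then have "0 < Re (1 + z)" using abs_Re_le_cmod[of z] by simp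
    then show "1 + z \<notin> \<real>\<^sub>\<le>\<^sub>0" by (auto simp: complex_nonpos_Reals_iff)
  qed
  show "(\<lambda>z. (q z)\<^sup>2 - 1) holomorphic_on unit_disc" using q by (intro holomorphic_intros)
  show "(\<lambda>z. (q z)\<^sup>2 - 1) ` unit_disc \<subseteq> unit_disc" using bd(1) by auto
  show "q z = csqrt (1 + ((q z)\<^sup>2 - 1))" if "z \<in> unit_disc" for z
    using csqrt_square[of "q z"] bd(2)[OF that] by simp
qed (use q in auto)

theorem theorem4p2:
  fixes f :: "complex \<Rightarrow> complex"
  assumes "f \<in> class_A"
    and "remove_sings (\<lambda>z.
           z * deriv f z / f z *
             (1 + z * (deriv ^^ 2) f z / deriv f z - z * deriv f z / f z)
         + z * deriv f z / f z *
             (z\<^sup>2 * (deriv ^^ 3) f z / deriv f z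
              - 3 * z\<^sup>2 * (deriv ^^ 2) f z / f z
              + 2 * z * (deriv ^^ 2) f z / deriv f z
              + 2 * (z * deriv f z / f z)\<^sup>2
              - 2 * z * deriv f z / f z))
         \<prec>\<^sub>s (\<lambda>z. 3 * z / (8 * complex_of_real (sqrt 2)))"
  shows "f \<in> class_SL"
proof -
  define X where "X = (\<lambda>z.
           z * deriv f z / f z *
             (1 + z * (deriv ^^ 2) f z / deriv f z - z * deriv f z / f z)
         + z * deriv f z / f z *
             (z\<^sup>2 * (deriv ^^ 3) f z / deriv f z
              - 3 * z\<^sup>2 * (deriv ^^ 2) f z / f z
              + 2 * z * (deriv ^^ 2) f z / deriv f z
              + 2 * (z * deriv f z / f z)\<^sup>2
              - 2 * z * deriv f z / f z))"
  define F where "F = remove_sings X"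
  have f: "f holomorphic_on unit_disc" "f 0 = 0" "deriv f 0 = 1"
    using assms(1) by (auto simp: class_A_def)
  obtain w where F: "F holomorphic_on unit_disc"
    and w: "w holomorphic_on unit_disc" "w ` unit_disc \<subseteq> unit_disc" "w 0 = 0"
    and Fw: "\<And>z. z \<in> unit_disc \<Longrightarrow> F z = 3 * w z / (8 * complex_of_real (sqrt 2))"
    using assms(2) unfolding X_def[symmetric] F_def[symmetric] subordinate_def by blast
  have F_bd: "norm (F z) \<le> 3/8 * norm z" if z: "norm z < 1" for z
  proof -
    have "norm (w z) \<le> norm z"
      by (rule Schwarz_Lemma(1)[OF w(1,3) _ z]) (use w(2) in force)
    then have "norm (F z) \<le> 3 * norm z / (8 * sqrt 2)"
      using Fw[of z] z by (simp add: norm_divide norm_mult divide_right_mono)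
    \<comment> \<open>The factor sqrt 2 is estimated by 1, since 3/8 is small enough for the final
      estimate.\<close>
    also have "\<dots> \<le> 3 * norm z / (8 * 1)"
      by (intro divide_left_mono mult_left_mono) auto
    finally show ?thesis by simp
  qed
  \<comment> \<open>\<open>A\<close> will turn out to be z p' and \<open>C\<close> to be p - 1. Both
    are built from \<open>F\<close> alone on the whole disc, so possible zeros of \<open>f\<close>
    do no harm.\<close>
  obtain A where A: "A holomorphic_on unit_disc" "A 0 = 0"
    "\<And>z. norm z < 1 \<Longrightarrow> z * deriv A z = F z" "\<And>z. norm z < 1 \<Longrightarrow> norm (A z) \<le> 3/8 * norm z"
    using euler_equation_solution[OF F zero_less_one F_bd] by blast
  obtain C where C: "C holomorphic_on unit_disc" "C 0 = 0"
    "\<And>z. norm z < 1 \<Longrightarrow> z * deriv C z = A z" "\<And>z. norm z < 1 \<Longrightarrow> norm (C z) \<le> 3/8 * norm z"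
    using euler_equation_solution[OF A(1) zero_less_one A(4)] by blast
  define q where "q = (\<lambda>z. 1 + C z)"
  have q: "q holomorphic_on unit_disc" "q 0 = 1"
    unfolding q_def using C by (auto intro!: holomorphic_intros)
  have q': "deriv q z = deriv C z" if "z \<in> unit_disc" for z
    unfolding q_def using C(1) that
    by (intro DERIV_imp_deriv) (auto intro!: derivative_eq_intros holomorphic_derivI)

  obtain \<phi> where \<phi>: "\<phi> holomorphic_on unit_disc" "\<And>z. norm z < 1 \<Longrightarrow> f z = z * \<phi> z" "\<phi> 0 = 1"
    using Schwarz3[OF f(1,2)] f(3) by metis
  have "isCont \<phi> 0" "isCont (deriv f) 0"
    using \<phi>(1) f(1) holomorphic_deriv[OF f(1) open_ball]
    by (auto simp: continuous_on_eq_continuous_at dest!: holomorphic_on_imp_continuous_on)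
  then obtain e1 e2 where e12: "e1 > 0" "e2 > 0"
    "\<And>z. dist z 0 < e1 \<Longrightarrow> \<phi> z \<noteq> 0" "\<And>z. dist z 0 < e2 \<Longrightarrow> deriv f z \<noteq> 0"
    using continuous_at_avoid[of 0 \<phi> 0] continuous_at_avoid[of 0 "deriv f" 0] \<phi>(3) f(3)
    by (metis dist_commute zero_neq_one)
  \<comment> \<open>On this radius both f(z)/z and f' are zero-free, and the ball stays in the unit
    disc.\<close>
  define e where "e = Min {1, e1, e2}"
  have e: "0 < e" "e \<le> 1" using e12 by (auto simp: e_def)
  have nz: "\<phi> z \<noteq> 0" "deriv f z \<noteq> 0" if "z \<in> ball 0 e" for z
    using e12(3,4)[of z] that by (auto simp: e_def)
  have sub: "ball 0 e \<subseteq> (unit_disc :: complex set)" using e by auto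
  have he: "\<phi> holomorphic_on ball 0 e" "deriv f holomorphic_on ball 0 e"
    using holomorphic_on_subset[OF _ sub] \<phi>(1) f(1) by (auto intro: holomorphic_deriv)
  \<comment> \<open>This form of z f'/f has the factor z cancelled, so it is holomorphic at 0 with
    value 1.\<close>
  define p where "p = (\<lambda>z. deriv f z / \<phi> z)"
  have p: "p holomorphic_on ball 0 e"
    unfolding p_def using he nz by (intro holomorphic_on_divide) auto
  have pX: "z * deriv (\<lambda>z. z * deriv p z) z = X z" if z: "z \<in> ball 0 e - {0}" for z
    unfolding X_def
  proof (rule euler_operator_quotient[where S = "ball 0 e - {0}"])
    show "f holomorphic_on ball 0 e - {0}" by (rule holomorphic_on_subset[OF f(1)]) (use e in auto)
    show "f y \<noteq> 0" "p y = y * deriv f y / f y" if "y \<in> ball 0 e - {0}" for y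
      using \<phi>(2)[of y] nz[of y] that e by (auto simp: p_def)
  qed (use z nz in auto)
  have hp: "(\<lambda>z. z * deriv p z) holomorphic_on ball 0 e"
    using p by (intro holomorphic_intros) auto
  have hpp: "(\<lambda>z. z * deriv (\<lambda>z. z * deriv p z) z) holomorphic_on ball 0 e"
    using p by (intro holomorphic_intros) auto
  \<comment> \<open>Off 0, \<open>X\<close> is already holomorphic near \<open>z\<close>, so
    \<open>remove_sings\<close> keeps its value; at 0 it returns the limit.\<close>
  have pF: "z * deriv (\<lambda>z. z * deriv p z) z = F z" if z: "z \<in> ball 0 e" for z
    unfolding F_def
  proof (cases "z = 0")
    case True
    show "z * deriv (\<lambda>z. z * deriv p z) z = remove_sings X z"
      by (rule remove_sings_eq_holomorphic[OF open_ball z, symmetric])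
        (use hpp pX True in auto)
  next
    case False
    show "z * deriv (\<lambda>z. z * deriv p z) z = remove_sings X z"
      by (rule remove_sings_eq_holomorphic[of "ball 0 e - {0}", symmetric])
        (use pX z False holomorphic_on_subset[OF hpp] in auto)
  qed
  \<comment> \<open>The two Euler equations are undone one after the other: z p' and
    \<open>A\<close> both vanish at 0, then \<open>p\<close> and \<open>q\<close> both equal 1
    there.\<close>
  have pA: "z * deriv p z = A z" if z: "z \<in> ball 0 e" for z
    by (rule euler_equation_unique[OF hp holomorphic_on_subset[OF A(1) sub] _ _ z])
      (use pF A(2,3) e in auto)
  have pq: "p z = q z" if z: "z \<in> ball 0 e" for z
    by (rule euler_equation_unique[OF p holomorphic_on_subset[OF q(1) sub] _ _ z])
      (use pA C(3) q' q(2) f(3) \<phi>(3) e in \<open>auto simp: p_def\<close>)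
  have "z * deriv f z = q z * f z" if z: "z \<in> ball 0 e" for z
    using pq[OF z] nz(1)[OF z] \<phi>(2)[of z] z e by (auto simp: p_def field_simps)
  then have cont: "z * deriv f z = q z * f z" "z \<noteq> 0 \<Longrightarrow> f z \<noteq> 0" if "z \<in> unit_disc" for z
    using logarithmic_derivative_continuation[OF f(1,2) _ q(1) e] f(3) that by auto
  \<comment> \<open>Zeros of \<open>f\<close> off the origin are now excluded, so the quotient
    equals \<open>q\<close> there, and its limit at 0 is q(0).\<close>
  have rq: "remove_sings (\<lambda>z. z * deriv f z / f z) z = q z" if z: "z \<in> unit_disc" for z
  proof (cases "z = 0")
    case True
    then show ?thesis
      by (intro remove_sings_eq_holomorphic[OF open_ball z q(1)]) (use cont in auto)
  next
    case False
    then show ?thesis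
      by (intro remove_sings_eq_holomorphic[of "unit_disc - {0}"])
        (use cont q(1) z in \<open>auto intro: holomorphic_on_subset\<close>)
  qed
  have C_bd: "norm (C z) < 3/8" if "z \<in> unit_disc" for z
    using C(4)[of z] that by simp
  have "q \<prec>\<^sub>s (\<lambda>z. csqrt (1 + z))"
  proof (rule subordinate_csqrtI[OF q])
    fix z :: complex assume z: "z \<in> unit_disc"
    show "0 < Re (q z)"
      using C_bd[OF z] abs_Re_le_cmod[of "C z"] by (simp add: q_def)
    \<comment> \<open>With q = 1 + C one has q^2 - 1 = C (2 + C), of modulus at most 3/8 times 19/8,
      that is 57/64.\<close>
    have "norm ((q z)\<^sup>2 - 1) = norm (C z) * norm (2 + C z)"
      by (simp add: q_def power2_eq_square algebra_simps flip: norm_mult)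
    also have "\<dots> \<le> 3/8 * (2 + 3/8)"
      using C_bd[OF z] norm_triangle_ineq[of 2 "C z"] by (intro mult_mono) auto
    finally show "norm ((q z)\<^sup>2 - 1) < 1" by simp
  qed
  moreover have "remove_sings (\<lambda>z. z * deriv f z / f z) holomorphic_on unit_disc"
    by (rule holomorphic_transform[OF q(1)]) (simp add: rq)
  ultimately have "remove_sings (\<lambda>z. z * deriv f z / f z) \<prec>\<^sub>s (\<lambda>z. csqrt (1 + z))"
    using rq unfolding subordinate_def by auto
  then show ?thesis using assms(1) by (simp add: class_SL_def)
qed

end
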